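(* Let $\mathcal{T}$ be a complete infinitely distributive lattice with a De Morgan complement, let $P$ be an annotated revision program over a set of atoms $U$ with annotations in $\mathcal{T}$, and let $B_I$ and $B_R$ be $\mathcal{T}^2$-valuations. If $B_R$ is a $P$-justified revision of $B_I$, then $B_R$ is an s-model of $P$ (and, hence, a model of $P$).
   Context: Lattice: $\mathcal{T}$ is a complete lattice with order $\le$, operations $\wedge,\vee$, bottom $\bot$, top $\top$, satisfying both infinite distributive laws ($a\vee\bigwedge S=\bigwedge_{s\in S}(a\vee s)$ and $a\wedge\bigvee S=\bigvee_{s\in S}(a\wedge s)$), with a De Morgan complement $\alpha\mapsto\overline{\alpha}$ (an order-reversing involution). Programs: $U$ is a set of atoms. Revision atoms are the formal expressions $\mathbf{in}(a)$, $\mathbf{out}(a)$, $a\in U$. An annotated revision atom is $(l:\alpha)$ with $l$ a revision atom and $\alpha\in\mathcal{T}$. An annotated revision rule is $p\leftarrow q_1,\dots,q_n$ ($n\ge 0$) with $p$ (head) and $q_1,\dots,q_n$ (body) annotated revision atoms. An annotated revision program is a set of such rules. Valuations: $\mathcal{T}^2=\mathcal{T}\times\mathcal{T}$ is ordered by $\langle\alpha_1,\beta_1\rangle\le_k\langle\alpha_2,\beta_2\rangle$ iff $\alpha_1\le\alpha_2$ and $\beta_1\le\beta_2$; its meet and join are $\otimes,\oplus$. Conflation is $-\langle\alpha,\beta\rangle=\langle\overline{\beta},\overline{\alpha}\rangle$. A $\mathcal{T}^2$-valuation is a map $B:U\to\mathcal{T}^2$; $\le_k,\otimes,\oplus,-$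 are extended pointwise. If $B(a)=\langle\alpha,\beta\rangle$, write $B[\mathbf{in}(a)]=\alpha$, $B[\mathbf{out}(a)]=\beta$. $B$ satisfies $(l:\alpha)$ if $\alpha\le B[l]$, and satisfies a body if it satisfies each of its members. $B$ is a model of $P$ if, for every rule of $P$, $B$ satisfies the head whenever it satisfies the body. Operator and necessary change: $T_P^b(B)$ is the $\mathcal{T}^2$-valuation with $T_P^b(B)[l]=\bigvee\{\alpha : (l:\alpha)$ is the head of a rule of $P$ whose body is satisfied by $B\}$ for each revision atom $l$. It is $\le_k$-monotone; its least fixpoint is the necessary change $NC(P)$. $B$ is an s-model of $P$ if $T_P^b(B)\le_k B\le_k T_P^b(B)\oplus(-T_P^b(B))$. Justified revisions: $\mathit{pcomp}(\alpha,\beta)$ is the least $\gamma\in\mathcal{T}$ with $\alpha\vee\gamma\ge\beta$. The reduct $P_{B_R}|B_I$ is obtained from $P$ by (1) removing every rule whose body contains an annotated revision atom not satisfied by $B_R$, and (2) replacing each $(l:\beta)$ in the body of each remaining rule by $(l:\mathit{pcomp}(B_I[l],\beta))$. $B_R$ is a $P$-justified revision of $B_I$ if $B_R=(B_I\otimes -C)\oplus C$ where $C=NC(P_{B_R}|B_I)$. *)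

theory Defs
  imports Main "HOL-Library.Product_Order"
begin

text \<open>
  The library class \<open>complete_distrib_lattice\<close> demands complete distributivity, which is
  strictly stronger than the two infinite distributive laws used here.  The De Morgan complement is
  written with the unary minus; no complementation law is assumed.
\<close>

class inf_distrib_de_morgan_lattice = complete_lattice + uminus +
  assumes sup_Inf_inf_distrib: "sup a (Inf S) = (INF s\<in>S. sup a s)"
    and inf_Sup_inf_distrib: "inf a (Sup S) = (SUP s\<in>S. inf a s)"
    and de_morgan_antimono: "a \<le> b \<Longrightarrow> - b \<le> - a"
    and de_morgan_involution: "- (- a) = a"

instance bool :: inf_distrib_de_morgan_lattice
  by standard (auto, metis (full_types))

datatype 'u rev_atom = In 'u | Out 'u

type_synonym ('u, 't) annot_atom = "'u rev_atom \<times> 't"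

datatype ('u, 't) annot_rule =
  Rule (head: "('u, 't) annot_atom") (body: "('u, 't) annot_atom list")

type_synonym ('u, 't) annot_program = "('u, 't) annot_rule set"

text \<open>
  The order on valuations is the library's pointwise order on functions and pairs, so
  \<open>\<le>\<close>, \<open>inf\<close> and \<open>sup\<close> are the knowledge order and its meet and join.
\<close>

type_synonym ('u, 't) valuation = "'u \<Rightarrow> 't \<times> 't"

fun val :: "('u, 't) valuation \<Rightarrow> 'u rev_atom \<Rightarrow> 't" where
  "val B (In a) = fst (B a)"
| "val B (Out a) = snd (B a)"

text \<open>
  Conflation swaps the components; it is not the componentwise unary minus which the library
  provides on pairs and functions.
\<close>

definition conflation_pair :: "'t::uminus \<times> 't \<Rightarrow> 't \<times> 't" where
  "conflation_pair p = (- snd p, - fst p)"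

definition conflation :: "('u, 't::uminus) valuation \<Rightarrow> ('u, 't) valuation" where
  "conflation B = (\<lambda>a. conflation_pair (B a))"

definition sat :: "('u, 't::ord) valuation \<Rightarrow> ('u, 't) annot_atom \<Rightarrow> bool" where
  "sat B q \<longleftrightarrow> snd q \<le> val B (fst q)"

definition sat_body :: "('u, 't::ord) valuation \<Rightarrow> ('u, 't) annot_atom list \<Rightarrow> bool" where
  "sat_body B qs \<longleftrightarrow> (\<forall>q\<in>set qs. sat B q)"

definition is_model :: "('u, 't::ord) annot_program \<Rightarrow> ('u, 't) valuation \<Rightarrow> bool" where
  "is_model P B \<longleftrightarrow> (\<forall>r\<in>P. sat_body B (body r) \<longrightarrow> sat B (head r))"

definition derived :: "('u, 't::complete_lattice) annot_program \<Rightarrow> ('u, 't) valuation \<Rightarrow>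
    'u rev_atom \<Rightarrow> 't" where
  "derived P B l = Sup {\<alpha>. \<exists>r\<in>P. head r = (l, \<alpha>) \<and> sat_body B (body r)}"

definition T_op :: "('u, 't::complete_lattice) annot_program \<Rightarrow> ('u, 't) valuation \<Rightarrow>
    ('u, 't) valuation" where
  "T_op P B = (\<lambda>a. (derived P B (In a), derived P B (Out a)))"

lemma val_T_op:
  "val (T_op P B) l = Sup {\<alpha>. \<exists>r\<in>P. head r = (l, \<alpha>) \<and> sat_body B (body r)}"
  by (cases l) (simp_all add: T_op_def derived_def)

lemma val_mono: "B \<le> B' \<Longrightarrow> val B l \<le> val B' l"
  by (cases l) (auto simp: le_fun_def less_eq_prod_def)

lemma sat_body_mono:
  fixes B B' :: "('u, 't::order) valuation"
  shows "B \<le> B' \<Longrightarrow> sat_body B qs \<Longrightarrow> sat_body B' qs"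
  unfolding sat_body_def sat_def by (meson order_trans val_mono)

lemma mono_T_op: "mono (T_op P)"
proof (rule monoI)
  fix B B' :: "('a, 'b) valuation"
  assume "B \<le> B'"
  then have "derived P B l \<le> derived P B' l" for l
    unfolding derived_def by (intro Sup_subset_mono) (auto intro: sat_body_mono)
  then show "T_op P B \<le> T_op P B'"
    by (simp add: T_op_def le_fun_def)
qed

definition necessary_change :: "('u, 't::complete_lattice) annot_program \<Rightarrow> ('u, 't) valuation" where
  "necessary_change P = lfp (T_op P)"

definition s_model :: "('u, 't::inf_distrib_de_morgan_lattice) annot_program \<Rightarrow>
    ('u, 't) valuation \<Rightarrow> bool" where
  "s_model P B \<longleftrightarrow> T_op P B \<le> B \<and> B \<le> sup (T_op P B) (conflation (T_op P B))"

definition pcomp :: "'t::lattice \<Rightarrow> 't \<Rightarrow> 't" where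
  "pcomp \<alpha> \<beta> = (LEAST \<gamma>. \<beta> \<le> sup \<alpha> \<gamma>)"

text \<open>The least element exists, so \<open>pcomp\<close> never takes an unspecified value.\<close>

lemma pcomp_le_iff:
  fixes \<alpha> \<beta> \<gamma> :: "'t::inf_distrib_de_morgan_lattice"
  shows "pcomp \<alpha> \<beta> \<le> \<gamma> \<longleftrightarrow> \<beta> \<le> sup \<alpha> \<gamma>"
proof -
  let ?m = "Inf {\<gamma>. \<beta> \<le> sup \<alpha> \<gamma>}"
  have m: "\<beta> \<le> sup \<alpha> ?m"
    unfolding sup_Inf_inf_distrib by (auto intro: INF_greatest)
  have "pcomp \<alpha> \<beta> = ?m"
    unfolding pcomp_def using m by (intro Least_equality) (auto intro: Inf_lower)
  moreover have "\<beta> \<le> sup \<alpha> \<gamma>" if "?m \<le> \<gamma>"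
    using m sup_mono[OF order_refl that] by (rule order_trans)
  ultimately show ?thesis
    by (auto intro: Inf_lower)
qed

text \<open>\<open>reduct P R I\<close> is the reduct of \<open>P\<close> with respect to the revision \<open>R\<close>
  and the initial valuation \<open>I\<close>.\<close>

definition reduct :: "('u, 't::lattice) annot_program \<Rightarrow> ('u, 't) valuation \<Rightarrow>
    ('u, 't) valuation \<Rightarrow> ('u, 't) annot_program" where
  "reduct P R I =
     (\<lambda>r. Rule (head r) (map (\<lambda>(l, \<beta>). (l, pcomp (val I l) \<beta>)) (body r))) `
       {r \<in> P. sat_body R (body r)}"

definition justified_revision :: "('u, 't::inf_distrib_de_morgan_lattice) annot_program \<Rightarrow>
    ('u, 't) valuation \<Rightarrow> ('u, 't) valuation \<Rightarrow> bool" where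
  "justified_revision P I R \<longleftrightarrow>
     (let C = necessary_change (reduct P R I) in R = sup (inf I (conflation C)) C)"

end

theory Submission
  imports Defs
begin

text \<open>
  Let \<open>C\<close> be the necessary change of the reduct, so \<open>B\<^sub>R = (B\<^sub>I \<otimes> -C) \<oplus> C\<close>.
  If \<open>B\<^sub>R\<close> satisfies \<open>(l:\<beta>)\<close>, then \<open>\<beta> \<le> B\<^sub>I[l] \<or> C[l]\<close>, that is,
  \<open>pcomp(B\<^sub>I[l], \<beta>) \<le> C[l]\<close>.  Hence every rule that survives in the reduct already fires
  at \<open>C\<close>, and the fixpoint equation for \<open>C\<close> becomes \<open>C = T\<^sub>P(B\<^sub>R)\<close>.
  Both inequalities of an s-model can then be read off the formula for \<open>B\<^sub>R\<close>.
\<close>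

lemma val_sup: "val (sup B B') l = sup (val B l) (val B' l)"
  by (cases l) simp_all

text \<open>A supremum lies below \<open>val B l\<close> iff each annotation contributing to it
  does.\<close>

lemma T_op_le_iff_is_model: "T_op P B \<le> B \<longleftrightarrow> is_model P B"
proof
  assume le: "T_op P B \<le> B"
  show "is_model P B"
    unfolding is_model_def
  proof (intro ballI impI)
    fix r assume r: "r \<in> P" "sat_body B (body r)"
    obtain l \<alpha> where h: "head r = (l, \<alpha>)"
      by (cases "head r")
    have "\<alpha> \<le> val (T_op P B) l"
      unfolding val_T_op using r h by (intro Sup_upper) auto
    also have "\<dots> \<le> val B l"
      using le by (rule val_mono)
    finally show "sat B (head r)"
      by (simp add: sat_def h)
  qed
next
  assume "is_model P B"
  then have "derived P B l \<le> val B l" for l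
    unfolding derived_def is_model_def sat_def by (intro Sup_least) auto
  from this[of "In _"] this[of "Out _"] show "T_op P B \<le> B"
    by (simp add: T_op_def le_fun_def less_eq_prod_def)
qed

text \<open>Atom by atom, this is the adjunction \<open>pcomp_le_iff\<close>.\<close>

lemma sat_body_pcomp:
  fixes I C :: "('u, 't::inf_distrib_de_morgan_lattice) valuation"
  shows "sat_body C (map (\<lambda>(l, \<beta>). (l, pcomp (val I l) \<beta>)) qs) \<longleftrightarrow> sat_body (sup I C) qs"
  by (auto simp: sat_body_def sat_def val_sup pcomp_le_iff split: prod.splits)

text \<open>A reduct rule fires at \<open>C\<close> iff its original body holds at both
  \<open>R\<close> and \<open>sup I C\<close>; by monotonicity the former implies the
  latter.\<close>

lemma T_op_reduct:
  fixes P :: "('u, 't::inf_distrib_de_morgan_lattice) annot_program"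
  assumes "R \<le> sup I C"
  shows "T_op (reduct P R I) C = T_op P R"
proof -
  have "derived (reduct P R I) C l = derived P R l" for l
    unfolding derived_def reduct_def
    using sat_body_mono[OF assms]
    by (intro arg_cong[where f = Sup]) (auto simp: sat_body_pcomp)
  then show ?thesis
    by (simp add: T_op_def)
qed

lemma necessary_change_reduct:
  assumes "justified_revision P I R"
  shows "necessary_change (reduct P R I) = T_op P R"
proof -
  let ?C = "necessary_change (reduct P R I)"
  have "R = sup (inf I (conflation ?C)) ?C"
    using assms by (simp add: justified_revision_def Let_def)
  also have "\<dots> \<le> sup I ?C"
    by (intro sup_mono inf_le1 order_refl)
  finally have "T_op (reduct P R I) ?C = T_op P R"
    by (rule T_op_reduct)
  then show ?thesis
    unfolding necessary_change_def using lfp_fixpoint[OF mono_T_op] by metis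
qed

theorem theorem5p5:
  fixes P :: "('u, 't::inf_distrib_de_morgan_lattice) annot_program"
    and B\<^sub>I B\<^sub>R :: "('u, 't) valuation"
  assumes "justified_revision P B\<^sub>I B\<^sub>R"
  shows "s_model P B\<^sub>R \<and> is_model P B\<^sub>R"
proof -
  let ?T = "T_op P B\<^sub>R"
  have R: "B\<^sub>R = sup (inf B\<^sub>I (conflation ?T)) ?T"
    using assms necessary_change_reduct[OF assms]
    by (simp add: justified_revision_def Let_def)
  have lower: "?T \<le> B\<^sub>R"
    \<comment> \<open>Only the right-hand \<open>B\<^sub>R\<close> is rewritten, not the one inside
      \<open>?T\<close>.\<close>
    by (subst (2) R) (rule sup_ge2)
  have "sup (inf B\<^sub>I (conflation ?T)) ?T \<le> sup ?T (conflation ?T)"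
    by (intro sup_least le_supI2 inf_le2 sup_ge1)
  with R have "B\<^sub>R \<le> sup ?T (conflation ?T)"
    by simp
  with lower show ?thesis
    by (simp add: s_model_def T_op_le_iff_is_model)
qed

end
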